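(* Let $0\le s_0<s<s_1$, $\delta\in\mathbb R$ and $\varepsilon>0$. Then there is a constant $C=C(\varepsilon)$ such that $$\|u\|_{H_{s,\delta}}\le\sqrt2\,\varepsilon\,\|u\|_{H_{s_1,\delta}}+C\|u\|_{H_{s_0,\delta}}$$ holds for all $u\in H_{s_1,\delta}$.
   Context: Weighted spaces: let $K_0=\{x\in\mathbb R^3:|x|\le4\}$, $K_j=\{2^{j-3}\le|x|\le2^{j+2}\}$ for $j\ge1$. Fix $\psi_j\in C_0^\infty(\mathbb R^3)$ with $\psi_j=1$ on $K_j$, $\operatorname{supp}\psi_j\subset\{2^{j-4}\le|x|\le2^{j+3}\}$ for $j\ge1$, $\operatorname{supp}\psi_0\subset\{|x|\le8\}$, and $|\partial^\beta\psi_j|\le C_\beta2^{-|\beta|j}$ with $C_\beta$ independent of $j$. Write $f_\varepsilon(x)=f(\varepsilon x)$ and let $H^s$ be the Bessel potential space, $\|u\|_{H^s}^2=\int(1+|\xi|^2)^s|\hat u|^2d\xi$. For $s\ge0,\delta\in\mathbb R$, $H_{s,\delta}$ is the space of tempered distributions on $\mathbb R^3$ with finite norm $\|u\|_{H_{s,\delta}}^2=\sum_{j\ge0}2^{(\frac32+\delta)2j}\|(\psi_ju)_{2^j}\|_{H^s}^2$. *)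

theory Defs
  imports "HOL-Analysis.Analysis"
begin

section \<open>Smooth functions and test functions on \<open>\<real>\<^sup>3\<close>\<close>

definition partial_deriv :: "3 \<Rightarrow> (real^3 \<Rightarrow> complex) \<Rightarrow> real^3 \<Rightarrow> complex" where
  "partial_deriv i f = (\<lambda>x. frechet_derivative f (at x) (axis i 1))"

text \<open>
  All iterated partial derivatives, in any order, exist and are (Frechet) differentiable;
  in particular they are all continuous, so this is the class of infinitely often
  differentiable functions.
\<close>

definition smooth :: "(real^3 \<Rightarrow> complex) \<Rightarrow> bool" where
  "smooth f \<longleftrightarrow> (\<forall>is. fold partial_deriv is f differentiable_on UNIV)"

type_synonym multi_index = "nat^3"

definition mi_order :: "multi_index \<Rightarrow> nat" where
  "mi_order \<beta> = (\<Sum>i\<in>UNIV. \<beta> $ i)"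

definition mi_deriv :: "multi_index \<Rightarrow> (real^3 \<Rightarrow> complex) \<Rightarrow> real^3 \<Rightarrow> complex" where
  "mi_deriv \<beta> f =
     (partial_deriv 1 ^^ (\<beta> $ 1)) ((partial_deriv 2 ^^ (\<beta> $ 2)) ((partial_deriv 3 ^^ (\<beta> $ 3)) f))"

definition supp :: "(real^3 \<Rightarrow> complex) \<Rightarrow> (real^3) set" where
  "supp f = closure {x. f x \<noteq> 0}"

definition test_function :: "(real^3 \<Rightarrow> complex) \<Rightarrow> bool" where
  "test_function f \<longleftrightarrow> smooth f \<and> compact (supp f)"


section \<open>Schwartz functions and tempered distributions\<close>

definition schwartz :: "(real^3 \<Rightarrow> complex) set" where
  "schwartz = {f. smooth f \<and>
     (\<forall>k \<beta>. bdd_above (range (\<lambda>x. (1 + norm x) ^ k * norm (mi_deriv \<beta> f x))))}"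

definition schwartz_seminorm :: "nat \<Rightarrow> multi_index \<Rightarrow> (real^3 \<Rightarrow> complex) \<Rightarrow> real" where
  "schwartz_seminorm k \<beta> f = (SUP x. (1 + norm x) ^ k * norm (mi_deriv \<beta> f x))"

text \<open>
  A distribution is a functional on functions of which only the values on \<^const>\<open>schwartz\<close>
  are relevant.
\<close>

type_synonym distribution = "(real^3 \<Rightarrow> complex) \<Rightarrow> complex"

definition tempered_distribution :: "distribution \<Rightarrow> bool" where
  "tempered_distribution u \<longleftrightarrow>
     (\<forall>f\<in>schwartz. \<forall>g\<in>schwartz. u (\<lambda>x. f x + g x) = u f + u g) \<and>
     (\<forall>c. \<forall>f\<in>schwartz. u (\<lambda>x. c * f x) = c * u f) \<and>
     (\<exists>C N. \<forall>f\<in>schwartz. norm (u f) \<le> C * (\<Sum>\<beta> | mi_order \<beta> \<le> N. schwartz_seminorm N \<beta> f))"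

definition dist_mult :: "(real^3 \<Rightarrow> complex) \<Rightarrow> distribution \<Rightarrow> distribution" where
  "dist_mult \<psi> u = (\<lambda>f. u (\<lambda>x. \<psi> x * f x))"

text \<open>
  The dilation \<open>u\<^sub>\<epsilon>(x) = u(\<epsilon>x)\<close>, for \<open>\<epsilon> > 0\<close>; the change of variables \<open>y = \<epsilon>x\<close> in
  \<open>\<integral>u(\<epsilon>x) f(x) dx\<close> gives the duality formula.
\<close>

definition dist_scale :: "real \<Rightarrow> distribution \<Rightarrow> distribution" where
  "dist_scale \<epsilon> u = (\<lambda>f. complex_of_real (1 / \<epsilon> ^ 3) * u (\<lambda>y. f ((1 / \<epsilon>) *\<^sub>R y)))"

text \<open>Unitary normalisation of the Fourier transform.\<close>

definition fourier :: "(real^3 \<Rightarrow> complex) \<Rightarrow> real^3 \<Rightarrow> complex" where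
  "fourier f = (\<lambda>\<xi>. complex_of_real ((2 * pi) powr (- 3 / 2)) *
                     (LINT x|lborel. exp (- \<i> * complex_of_real (x \<bullet> \<xi>)) * f x))"

definition dist_fourier :: "distribution \<Rightarrow> distribution" where
  "dist_fourier u = (\<lambda>f. u (fourier f))"

definition represents :: "(real^3 \<Rightarrow> complex) \<Rightarrow> distribution \<Rightarrow> bool" where
  "represents g u \<longleftrightarrow> g \<in> borel_measurable lborel \<and>
     (\<forall>f\<in>schwartz. integrable lborel (\<lambda>x. g x * f x) \<and> u f = (LINT x|lborel. g x * f x))"


section \<open>Bessel potential norms and weighted norms\<close>

definition enn_sqrt :: "ennreal \<Rightarrow> ennreal" where
  "enn_sqrt a = (if a = \<infinity> then \<infinity> else ennreal (sqrt (enn2real a)))"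

text \<open>
  The norm is \<open>\<infinity>\<close> if the Fourier transform of \<open>u\<close> is not a function. Otherwise the function
  representing it is unique up to null sets, so that the choice made by \<open>SOME\<close> does not
  affect the integral.
\<close>

definition sobolev_norm :: "real \<Rightarrow> distribution \<Rightarrow> ennreal" where
  "sobolev_norm s u =
     (if \<exists>g. represents g (dist_fourier u)
      then let g = (SOME g. represents g (dist_fourier u)) in
        enn_sqrt (\<integral>\<^sup>+\<xi>. ennreal ((1 + (norm \<xi>)\<^sup>2) powr s * (norm (g \<xi>))\<^sup>2) \<partial>lborel)
      else \<infinity>)"

definition dyadic_shell :: "nat \<Rightarrow> (real^3) set" where
  "dyadic_shell j =
     (if j = 0 then {x. norm x \<le> 4}
      else {x. 2 powr (real j - 3) \<le> norm x \<and> norm x \<le> 2 powr (real j + 2)})"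

definition dyadic_cutoffs :: "(nat \<Rightarrow> real^3 \<Rightarrow> complex) \<Rightarrow> bool" where
  "dyadic_cutoffs \<psi> \<longleftrightarrow>
     (\<forall>j. test_function (\<psi> j)) \<and>
     (\<forall>j. \<forall>x\<in>dyadic_shell j. \<psi> j x = 1) \<and>
     supp (\<psi> 0) \<subseteq> {x. norm x \<le> 8} \<and>
     (\<forall>j\<ge>1. supp (\<psi> j) \<subseteq> {x. 2 powr (real j - 4) \<le> norm x \<and> norm x \<le> 2 powr (real j + 3)}) \<and>
     (\<forall>\<beta>. \<exists>C. \<forall>j x. norm (mi_deriv \<beta> (\<psi> j) x) \<le> C * 2 powr (- (real (mi_order \<beta>) * real j)))"

definition weighted_norm ::
    "(nat \<Rightarrow> real^3 \<Rightarrow> complex) \<Rightarrow> real \<Rightarrow> real \<Rightarrow> distribution \<Rightarrow> ennreal" where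
  "weighted_norm \<psi> s \<delta> u =
     enn_sqrt (\<Sum>j. ennreal (2 powr ((3 / 2 + \<delta>) * 2 * real j)) *
                    (sobolev_norm s (dist_scale (2 ^ j) (dist_mult (\<psi> j) u)))\<^sup>2)"

definition weighted_space ::
    "(nat \<Rightarrow> real^3 \<Rightarrow> complex) \<Rightarrow> real \<Rightarrow> real \<Rightarrow> distribution set" where
  "weighted_space \<psi> s \<delta> = {u. tempered_distribution u \<and> weighted_norm \<psi> s \<delta> u < \<infinity>}"

end

theory Submission
  imports Defs
begin

text \<open>
  The Sobolev norms of all orders are weighted \<open>L\<^sup>2\<close> norms of the same function. The inequality
  \<open>x powr s \<le> \<eta>\<^sup>2 x powr s\<^sub>1 + B x powr s\<^sub>0\<close> for \<open>x = 1 + |\<xi>|\<^sup>2\<close> can therefore be integrated and then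
  summed over the dyadic shells. As the square root is subadditive, \<open>\<eta> = sqrt 2 * \<epsilon>\<close> gives the claim.
\<close>

text \<open>Split at a threshold: for large \<open>x\<close> the negative power
  \<open>x powr (s - s\<^sub>1)\<close> is at most \<open>A\<close>, and below the threshold the
  positive power \<open>x powr (s - s\<^sub>0)\<close> is bounded, which gives
  \<open>B\<close>.\<close>

lemma powr_interpolation:
  fixes A s\<^sub>0 s s\<^sub>1 :: real
  assumes "A > 0" "s\<^sub>0 < s" "s < s\<^sub>1"
  obtains B where "B \<ge> 0" "\<And>x::real. x > 0 \<Longrightarrow> x powr s \<le> A * x powr s\<^sub>1 + B * x powr s\<^sub>0"
proof -
  \<comment> \<open>The crossover point, where \<open>x powr s\<close> equals
    \<open>A * x powr s\<^sub>1\<close>.\<close>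
  define R where "R = A powr (1 / (s - s\<^sub>1))"
  have R: "R > 0" "R powr (s - s\<^sub>1) = A"
    using assms by (auto simp: R_def powr_powr)
  have "x powr s \<le> A * x powr s\<^sub>1 + R powr (s - s\<^sub>0) * x powr s\<^sub>0" if x: "x > 0" for x
  proof (cases "x \<ge> R")
    case True
    have "x powr s = x powr (s - s\<^sub>1) * x powr s\<^sub>1"
      by (simp flip: powr_add)
    also have "\<dots> \<le> R powr (s - s\<^sub>1) * x powr s\<^sub>1"
      using True R assms by (intro mult_right_mono powr_mono2') auto
    finally show ?thesis
      using R by (simp add: add_increasing2)
  next
    case False
    have "x powr s = x powr (s - s\<^sub>0) * x powr s\<^sub>0"
      by (simp flip: powr_add)
    also have "\<dots> \<le> R powr (s - s\<^sub>0) * x powr s\<^sub>0"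
      using False x assms by (intro mult_right_mono powr_mono2) auto
    finally show ?thesis
      using assms by (simp add: add_increasing)
  qed
  then show ?thesis
    by (intro that[of "R powr (s - s\<^sub>0)"]) auto
qed

lemma enn_sqrt_power2 [simp]: "(enn_sqrt a)\<^sup>2 = a"
  by (cases a) (auto simp: enn_sqrt_def ennreal_power ennreal_top_eq_mult_iff power2_eq_square
      simp flip: ennreal_mult)

lemma enn_sqrt_le:
  assumes "a \<le> b\<^sup>2"
  shows "enn_sqrt a \<le> b"
proof (cases b)
  case (real r)
  with assms have a: "a \<le> ennreal (r\<^sup>2)"
    by (simp add: ennreal_power)
  then obtain x where "a = ennreal x" "x \<ge> 0"
    by (cases a) (auto simp: top_unique)
  with a real show ?thesis
    by (auto simp: enn_sqrt_def intro!: ennreal_leI real_le_lsqrt)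
qed simp

text \<open>Subadditivity of the square root: completing the square only adds a nonnegative cross
  term. The coefficients are squared so that they leave the root as \<open>c\<close> and
  \<open>d\<close>.\<close>

lemma enn_sqrt_add_le:
  assumes "x \<le> c\<^sup>2 * a + d\<^sup>2 * b"
  shows "enn_sqrt x \<le> c * enn_sqrt a + d * enn_sqrt b"
proof (rule enn_sqrt_le)
  have "c\<^sup>2 * a + d\<^sup>2 * b = (c * enn_sqrt a)\<^sup>2 + (d * enn_sqrt b)\<^sup>2"
    by (simp add: power_mult_distrib)
  also have "\<dots> \<le> (c * enn_sqrt a + d * enn_sqrt b)\<^sup>2"
    by (simp only: power2_sum) simp
  finally show "x \<le> (c * enn_sqrt a + d * enn_sqrt b)\<^sup>2"
    using assms by simp
qed

text \<open>Stated for squared norms, which are integrals linear in the weight, so that the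
  pointwise inequality integrates with unchanged constants.\<close>

lemma sobolev_norm_interpolation:
  fixes A B s\<^sub>0 s s\<^sub>1 :: real
  assumes "A > 0" "B \<ge> 0"
    and symbol: "\<And>x::real. x > 0 \<Longrightarrow> x powr s \<le> A * x powr s\<^sub>1 + B * x powr s\<^sub>0"
  shows "(sobolev_norm s u)\<^sup>2
    \<le> ennreal A * (sobolev_norm s\<^sub>1 u)\<^sup>2 + ennreal B * (sobolev_norm s\<^sub>0 u)\<^sup>2"
proof (cases "\<exists>g. represents g (dist_fourier u)")
  \<comment> \<open>All three norms are infinite here; \<open>A > 0\<close> keeps the right-hand
    side infinite.\<close>
  case False
  with \<open>A > 0\<close> show ?thesis
    by (simp add: sobolev_norm_def ennreal_mult_top)
next
  case True
  \<comment> \<open>The choice does not involve the order, so one \<open>g\<close> serves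
    \<open>s\<^sub>0\<close>, \<open>s\<close> and \<open>s\<^sub>1\<close>.\<close>
  define g where "g = (SOME g. represents g (dist_fourier u))"
  have "represents g (dist_fourier u)"
    unfolding g_def using True by (rule someI_ex)
  then have [measurable]: "g \<in> borel_measurable borel"
    by (simp add: represents_def)
  define w where "w t \<xi> = (1 + (norm \<xi>)\<^sup>2) powr t * (norm (g \<xi>))\<^sup>2" for t \<xi>
  have norm_eq: "(sobolev_norm t u)\<^sup>2 = (\<integral>\<^sup>+\<xi>. ennreal (w t \<xi>) \<partial>lborel)" for t
    using True by (simp add: sobolev_norm_def g_def w_def)
  have [measurable]: "w t \<in> borel_measurable borel" for t
    unfolding w_def by measurable
  have w_nonneg: "w t \<xi> \<ge> 0" for t \<xi>
    by (simp add: w_def)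
  have "w s \<xi> \<le> A * w s\<^sub>1 \<xi> + B * w s\<^sub>0 \<xi>" for \<xi>
    using mult_right_mono[OF symbol, of "1 + (norm \<xi>)\<^sup>2" "(norm (g \<xi>))\<^sup>2"]
    by (simp add: w_def algebra_simps add_pos_nonneg)
  then have "ennreal (w s \<xi>) \<le> ennreal A * ennreal (w s\<^sub>1 \<xi>) + ennreal B * ennreal (w s\<^sub>0 \<xi>)" for \<xi>
    using assms w_nonneg by (simp add: ennreal_leI flip: ennreal_mult ennreal_plus)
  then have "(\<integral>\<^sup>+\<xi>. ennreal (w s \<xi>) \<partial>lborel) \<le>
      (\<integral>\<^sup>+\<xi>. ennreal A * ennreal (w s\<^sub>1 \<xi>) + ennreal B * ennreal (w s\<^sub>0 \<xi>) \<partial>lborel)"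
    by (intro nn_integral_mono)
  then show ?thesis
    by (simp add: norm_eq nn_integral_add nn_integral_cmult)
qed

text \<open>The constant comes from the pointwise inequality alone, hence is the same for every
  shell \<open>j\<close> and every \<open>u\<close>.\<close>

lemma weighted_norm_interpolation:
  fixes \<eta> s\<^sub>0 s s\<^sub>1 :: real
  assumes "\<eta> > 0" "s\<^sub>0 < s" "s < s\<^sub>1"
  obtains C :: real where "C \<ge> 0"
    "\<And>u. weighted_norm \<psi> s \<delta> u
      \<le> ennreal \<eta> * weighted_norm \<psi> s\<^sub>1 \<delta> u + ennreal C * weighted_norm \<psi> s\<^sub>0 \<delta> u"
proof -
  obtain B where B: "B \<ge> 0"
    and symbol: "\<And>x::real. x > 0 \<Longrightarrow> x powr s \<le> \<eta>\<^sup>2 * x powr s\<^sub>1 + B * x powr s\<^sub>0"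
    using powr_interpolation[of "\<eta>\<^sup>2" s\<^sub>0 s s\<^sub>1] assms by auto
  have "weighted_norm \<psi> s \<delta> u
      \<le> ennreal \<eta> * weighted_norm \<psi> s\<^sub>1 \<delta> u + ennreal (sqrt B) * weighted_norm \<psi> s\<^sub>0 \<delta> u" for u
  proof -
    define c where "c j = ennreal (2 powr ((3 / 2 + \<delta>) * 2 * real j))" for j
    define N where "N t j = (sobolev_norm t (dist_scale (2 ^ j) (dist_mult (\<psi> j) u)))\<^sup>2" for t j
    have "N s j \<le> ennreal (\<eta>\<^sup>2) * N s\<^sub>1 j + ennreal B * N s\<^sub>0 j" for j
      unfolding N_def using assms B symbol by (intro sobolev_norm_interpolation) auto
    then have "c j * N s j \<le> c j * (ennreal (\<eta>\<^sup>2) * N s\<^sub>1 j + ennreal B * N s\<^sub>0 j)" for j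
      by (intro mult_left_mono) auto
    \<comment> \<open>Series in \<open>ennreal\<close> always converge, so termwise comparison and
      splitting need no summability argument.\<close>
    then have "(\<Sum>j. c j * N s j) \<le>
        (\<Sum>j. ennreal (\<eta>\<^sup>2) * (c j * N s\<^sub>1 j) + ennreal B * (c j * N s\<^sub>0 j))"
      by (intro suminf_le) (auto simp: algebra_simps)
    also have "\<dots> = ennreal (\<eta>\<^sup>2) * (\<Sum>j. c j * N s\<^sub>1 j) + ennreal B * (\<Sum>j. c j * N s\<^sub>0 j)"
      by (simp flip: suminf_add)
    also have "\<dots> = (ennreal \<eta>)\<^sup>2 * (\<Sum>j. c j * N s\<^sub>1 j)
        + (ennreal (sqrt B))\<^sup>2 * (\<Sum>j. c j * N s\<^sub>0 j)"
      using assms B by (simp add: ennreal_power)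
    finally show ?thesis
      unfolding weighted_norm_def c_def N_def by (rule enn_sqrt_add_le)
  qed
  with B show ?thesis
    \<comment> \<open>\<open>B\<close> multiplies a squared norm, so its root multiplies the
      norm.\<close>
    by (intro that[of "sqrt B"]) auto
qed

theorem proposition8p6:
  fixes \<psi> :: "nat \<Rightarrow> real^3 \<Rightarrow> complex"
    and s\<^sub>0 s s\<^sub>1 \<delta> \<epsilon> :: real
  assumes "dyadic_cutoffs \<psi>"
    and "0 \<le> s\<^sub>0" and "s\<^sub>0 < s" and "s < s\<^sub>1"
    and "\<epsilon> > 0"
  shows "\<exists>C::real. C \<ge> 0 \<and>
    (\<forall>u \<in> weighted_space \<psi> s\<^sub>1 \<delta>.
       weighted_norm \<psi> s \<delta> u
         \<le> ennreal (sqrt 2 * \<epsilon>) * weighted_norm \<psi> s\<^sub>1 \<delta> u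
            + ennreal C * weighted_norm \<psi> s\<^sub>0 \<delta> u)"
  using weighted_norm_interpolation[of "sqrt 2 * \<epsilon>" s\<^sub>0 s s\<^sub>1 \<psi> \<delta>] assms
  by (metis mult_pos_pos real_sqrt_gt_zero zero_less_numeral)

end
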